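(* Let $\lambda$ be a weakly inaccessible cardinal such that the sequence $\langle 2^\theta:\theta<\lambda\rangle$ ($\theta$ ranging over cardinals below $\lambda$) is not eventually constant. Then for some cardinal $\mu\leq 2^\lambda$ Galvin's property holds on $\mathcal{D}_\lambda$ with respect to $\mu$; that is, for every family $\{C_\alpha:\alpha<\mu\}\subseteq\mathcal{D}_\lambda$ there is $I\subseteq\mu$ with $|I|=\lambda$ such that $\bigcap_{\alpha\in I}C_\alpha\in\mathcal{D}_\lambda$.
   Context: A weakly inaccessible cardinal is an uncountable regular limit cardinal. $\mathcal{D}_\lambda$ denotes the club filter on $\lambda$: the collection of all subsets of $\lambda$ that contain a closed unbounded subset of $\lambda$. Families are indexed families. *)

theory Defs
  imports Main
begin

unbundle cardinal_syntax

text \<open>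
  A cardinal is a well-order relation satisfying \<^const>\<open>card_order_on\<close> on its field, i.e. an initial
  ordinal up to isomorphism; the ordinals below it are the elements of its field. Every
  cardinal below \<open>r :: 'a rel\<close> is order isomorphic to one on a subset of \<open>'a\<close>, so quantifying over
  \<open>\<theta> :: 'a rel\<close> with \<open>Card_order \<theta>\<close> and \<open>\<theta> <o r\<close> covers all cardinals below \<open>r\<close>.
\<close>

definition uncountable_card :: "'a rel \<Rightarrow> bool" where
  "uncountable_card r \<longleftrightarrow> natLeq <o r"

definition limit_card :: "'a rel \<Rightarrow> bool" where
  "limit_card r \<longleftrightarrow> (\<forall>\<theta> :: 'a rel. Card_order \<theta> \<and> \<theta> <o r \<longrightarrow> cardSuc \<theta> <o r)"

definition weakly_inaccessible :: "'a rel \<Rightarrow> bool" where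
  "weakly_inaccessible r \<longleftrightarrow>
     Card_order r \<and> uncountable_card r \<and> regularCard r \<and> limit_card r"

text \<open>
  The common value of an eventually constant sequence need not be named: it is enough that
  \<open>2\<^sup>\<theta>\<close> and \<open>2\<^sup>\<theta>'\<close> are equinumerous for all cardinals \<open>\<theta>\<close>, \<open>\<theta>'\<close> between some
  \<open>\<theta>\<^sub>0 < r\<close> and \<open>r\<close>.
\<close>

definition powers_eventually_constant :: "'a rel \<Rightarrow> bool" where
  "powers_eventually_constant r \<longleftrightarrow>
     (\<exists>\<theta>0 :: 'a rel. Card_order \<theta>0 \<and> \<theta>0 <o r \<and>
        (\<forall>(\<theta> :: 'a rel) (\<theta>' :: 'a rel).
           Card_order \<theta> \<and> \<theta>0 \<le>o \<theta> \<and> \<theta> <o r \<and> Card_order \<theta>' \<and> \<theta>0 \<le>o \<theta>' \<and> \<theta>' <o r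
           \<longrightarrow> ctwo ^c \<theta> =o ctwo ^c \<theta>'))"

text \<open>
  Closedness: a nonzero \<open>\<delta>\<close> below which \<open>C\<close> is unbounded belongs to \<open>C\<close>. Since the bound
  is strict, such a \<open>\<delta>\<close> is necessarily a limit; without \<open>underS r \<delta> \<noteq> {}\<close> the condition would
  force the least element into \<open>C\<close>.
\<close>

definition closed_in_card :: "'a rel \<Rightarrow> 'a set \<Rightarrow> bool" where
  "closed_in_card r C \<longleftrightarrow>
     (\<forall>\<delta> \<in> Field r. underS r \<delta> \<noteq> {} \<and>
        (\<forall>\<beta> \<in> underS r \<delta>. \<exists>\<gamma> \<in> C \<inter> underS r \<delta>. \<beta> \<noteq> \<gamma> \<and> (\<beta>, \<gamma>) \<in> r) \<longrightarrow> \<delta> \<in> C)"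

definition club :: "'a rel \<Rightarrow> 'a set \<Rightarrow> bool" where
  "club r C \<longleftrightarrow> C \<subseteq> Field r \<and> closed_in_card r C \<and> cofinal C r"

definition club_filter :: "'a rel \<Rightarrow> 'a set set" where
  "club_filter r = {X. X \<subseteq> Field r \<and> (\<exists>C. club r C \<and> C \<subseteq> X)}"

text \<open>
  Galvin's property of a family of sets \<open>F\<close> with respect to \<open>m\<close>, where \<open>r\<close> is the required
  size of the subfamily. Families are indexed, possibly with repetitions, and \<open>I\<close> is a set of
  indices.
\<close>

definition galvin_property :: "'a rel \<Rightarrow> 'a set set \<Rightarrow> 'b rel \<Rightarrow> bool" where
  "galvin_property r F m \<longleftrightarrow>
     (\<forall>C :: 'b \<Rightarrow> 'a set. (\<forall>\<alpha> \<in> Field m. C \<alpha> \<in> F) \<longrightarrow>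
        (\<exists>I \<subseteq> Field m. |I| =o r \<and> (\<Inter>\<alpha>\<in>I. C \<alpha>) \<in> F))"

end

theory Submission
  imports Defs
begin

text \<open>
  The witness is \<open>2\<^sup>\<lambda>\<close> itself, realised as the cardinality of the power set of \<open>\<lambda> = Field r\<close>.

  Suppose that \<open>2\<^sup>\<theta> = 2\<^sup>\<lambda>\<close> for some \<open>\<theta> < \<lambda>\<close>. Then the sequence of powers is constant from \<open>\<theta>\<close> on,
  which is excluded. Hence \<open>2\<^sup>\<theta> < 2\<^sup>\<lambda>\<close> for every \<open>\<theta> < \<lambda>\<close> (\<open>Pow_small_subset_smaller\<close>), and since
  the cofinality of \<open>2\<^sup>\<lambda>\<close> exceeds \<open>\<lambda>\<close> (\<open>koenig_Pow_not_covered\<close>), the same gap survives unions of length \<open>\<lambda>\<close>.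

  Choose a club \<open>D \<alpha>\<close> inside the \<open>\<alpha>\<close>-th member of the family, for \<open>\<alpha> < 2\<^sup>\<lambda>\<close>, and colour \<open>\<alpha>\<close> at level \<open>i < \<lambda>\<close> with the trace of \<open>D \<alpha>\<close> on \<open>[0, i]\<close>.
  Each level has fewer than \<open>2\<^sup>\<lambda>\<close> colours, so counting yields one index \<open>X\<close> such that at every level
  at least \<open>\<lambda>\<close> indices have the same trace as \<open>X\<close> (\<open>colourings_common_large_class\<close>). Choose distinct
  indices \<open>f i\<close>, where \<open>f i\<close> agrees with \<open>X\<close> at level \<open>i\<close>. Let \<open>x\<close> be in \<open>D X\<close> and in the diagonal
  intersection of the sets \<open>D (f i)\<close>. It lies in \<open>D (f i)\<close> for \<open>i < x\<close> by diagonality, and for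
  \<open>i \<ge> x\<close> because there \<open>D (f i)\<close> and \<open>D X\<close> have the same trace on \<open>[0, i]\<close>. So the intersection of
  all \<open>D (f i)\<close> contains \<open>D X\<close> intersected with a diagonal intersection of clubs, which is a club
  because \<open>\<lambda>\<close> is regular and uncountable (\<open>club_Int_diagonal\<close>).
\<close>

section \<open>Cardinal arithmetic\<close>

text \<open>
  Koenig's theorem for \<open>2\<^sup>A\<close>, in the form that \<open>cf(2\<^sup>A) > |A|\<close>. A pairing of \<open>A\<close> turns each subset of
  \<open>A\<close> into an \<open>A\<close>-indexed family of rows. The sets in \<open>B i\<close> are too few to realise every possible
  \<open>i\<close>-th row, so one can diagonalise against all the \<open>B i\<close> at once.
\<close>

lemma koenig_Pow_not_covered:
  assumes inf: "infinite A" and small: "\<And>i. i \<in> A \<Longrightarrow> |B i| <o |Pow A|"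
  shows "\<not> Pow A \<subseteq> (\<Union>i\<in>A. B i)"
proof
  assume cover: "Pow A \<subseteq> (\<Union>i\<in>A. B i)"
  obtain p where p: "bij_betw p (A \<times> A) A"
    using card_of_Times_same_infinite[OF inf] card_of_ordIso by blast
  define row where "row = (\<lambda>i X. {y \<in> A. p (i, y) \<in> X})"
  have "\<exists>Y. Y \<subseteq> A \<and> Y \<notin> row i ` B i" if "i \<in> A" for i
  proof (rule ccontr)
    assume "\<nexists>Y. Y \<subseteq> A \<and> Y \<notin> row i ` B i"
    then have "Pow A \<subseteq> row i ` B i" by blast
    then have "|Pow A| \<le>o |B i|"
      by (rule surj_imp_ordLeq)
    then show False
      using small[OF that] not_ordLess_ordLeq by blast
  qed
  then obtain g where g: "\<And>i. i \<in> A \<Longrightarrow> g i \<subseteq> A \<and> g i \<notin> row i ` B i"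
    by metis
  define X where "X = p ` (SIGMA i : A. g i)"
  have sub: "(SIGMA i : A. g i) \<subseteq> A \<times> A"
    using g by blast
  have "X \<subseteq> A"
    using p sub unfolding X_def bij_betw_def by blast
  then obtain i where i: "i \<in> A" "X \<in> B i"
    using cover by blast
  have "p (i, y) \<in> X \<longleftrightarrow> y \<in> g i" if "y \<in> A" for y
  proof -
    have "p (i, y) \<in> X \<longleftrightarrow> (i, y) \<in> (SIGMA i : A. g i)"
      unfolding X_def using inj_on_image_mem_iff[OF bij_betw_imp_inj_on[OF p] _ sub] i that
      by blast
    then show ?thesis using i by blast
  qed
  then have "row i X = g i"
    unfolding row_def using g[OF i(1)] by auto
  then show False
    using g[OF i(1)] i(2) by blast
qed

text \<open>
  Otherwise every \<open>X\<close> has a level \<open>i\<close> at which its colour class is smaller than \<open>A\<close>. The sets \<open>X\<close> with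
  a given \<open>i\<close> split into fewer than \<open>2\<^sup>A\<close> classes, each of size below \<open>|A| < 2\<^sup>A\<close>, so there are fewer
  than \<open>2\<^sup>A\<close> of them. This contradicts Koenig's theorem.
\<close>

lemma colourings_common_large_class:
  fixes c :: "'a \<Rightarrow> 'a set \<Rightarrow> 'c"
  assumes inf: "infinite A" and few: "\<And>i. i \<in> A \<Longrightarrow> |c i ` Pow A| <o |Pow A|"
  shows "\<exists>X \<in> Pow A. \<forall>i \<in> A. |A| \<le>o |{Y \<in> Pow A. c i Y = c i X}|"
proof (rule ccontr)
  assume "\<not> ?thesis"
  then have neg: "\<exists>i \<in> A. \<not> |A| \<le>o |{Y \<in> Pow A. c i Y = c i X}|" if "X \<in> Pow A" for X
    using that by blast
  define B where "B = (\<lambda>i. {X \<in> Pow A. |{Y \<in> Pow A. c i Y = c i X}| <o |A|})"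
  have "Pow A \<subseteq> (\<Union>i\<in>A. B i)"
    using neg unfolding B_def
    by (fastforce simp: not_ordLeq_iff_ordLess card_of_Well_order)
  moreover have "|B i| <o |Pow A|" if i: "i \<in> A" for i
  proof -
    \<comment> \<open>The sum dominates both the number and the size of the colour classes that make up \<open>B i\<close>.\<close>
    let ?D = "c i ` Pow A <+> A"
    have D: "|?D| <o |Pow A|"
      using card_of_Plus_ordLess_infinite[OF _ few[OF i] card_of_Pow] inf by simp
    have fib: "|{Y \<in> B i. c i Y = k}| \<le>o |?D|" for k
    proof (cases "{Y \<in> B i. c i Y = k} = {}")
      case True
      then show ?thesis by (metis card_of_empty)
    next
      case False
      then obtain X where X: "X \<in> B i" "c i X = k" by blast
      have "|{Y \<in> B i. c i Y = k}| \<le>o |{Y \<in> Pow A. c i Y = c i X}|"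
        using X by (intro card_of_mono1) (auto simp: B_def)
      also have "|{Y \<in> Pow A. c i Y = c i X}| \<le>o |A|"
        using X(1) ordLess_imp_ordLeq unfolding B_def by blast
      also have "|A| \<le>o |?D|" by (rule card_of_Plus2)
      finally show ?thesis .
    qed
    have "|\<Union>k \<in> c i ` Pow A. {Y \<in> B i. c i Y = k}| \<le>o |?D|"
      using fib inf by (intro card_of_UNION_ordLeq_infinite ballI card_of_Plus1) auto
    moreover have "B i \<subseteq> (\<Union>k \<in> c i ` Pow A. {Y \<in> B i. c i Y = k})"
      unfolding B_def by blast
    ultimately have "|B i| \<le>o |?D|"
      using card_of_mono1 ordLeq_transitive by blast
    then show ?thesis
      using D ordLeq_ordLess_trans by blast
  qed
  ultimately show False
    using koenig_Pow_not_covered[OF inf, of B] by blast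
qed

text \<open>
  Transfinite recursion: fewer than \<open>r\<close> elements have been used before stage \<open>e\<close>, so they do not
  exhaust \<open>H e\<close>.
\<close>

lemma injective_choice_from_large_sets:
  assumes r: "Card_order r" and large: "\<And>e. e \<in> Field r \<Longrightarrow> r \<le>o |H e|"
  shows "\<exists>f. inj_on f (Field r) \<and> (\<forall>e \<in> Field r. f e \<in> H e)"
proof -
  have wo: "Well_order r" using r by (simp add: card_order_on_well_order_on)
  interpret wo_rel r by (standard) (rule wo)
  have "\<exists>f. \<forall>x. x \<in> Field r \<longrightarrow> f x \<in> H x - f ` underS x"
  proof (rule dependent_wf_choice[where R = "r - Id"])
    show "wf (r - Id)" using wo by (simp add: well_order_on_def)
  next
    fix f g :: "'a \<Rightarrow> 'b" and x b
    assume "\<And>z. (z, x) \<in> r - Id \<Longrightarrow> f z = g z"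
    then have "f ` underS x = g ` underS x"
      by (intro image_cong) (auto simp: underS_def)
    then show "(x \<in> Field r \<longrightarrow> b \<in> H x - f ` underS x) = (x \<in> Field r \<longrightarrow> b \<in> H x - g ` underS x)"
      by simp
  next
    fix x and f :: "'a \<Rightarrow> 'b"
    have "\<exists>b. b \<in> H x - f ` underS x" if x: "x \<in> Field r"
    proof (rule ccontr)
      assume "\<nexists>b. b \<in> H x - f ` underS x"
      then have "H x \<subseteq> f ` underS x" by blast
      then have "|H x| \<le>o |underS x|" by (rule surj_imp_ordLeq)
      then have "|H x| <o r"
        using card_of_underS[OF r x] ordLeq_ordLess_trans by blast
      then show False using large[OF x] not_ordLess_ordLeq by blast
    qed
    then show "\<exists>b. x \<in> Field r \<longrightarrow> b \<in> H x - f ` underS x" by blast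
  qed
  then obtain f where f: "\<And>x. x \<in> Field r \<Longrightarrow> f x \<in> H x - f ` underS x" by blast
  have "inj_on f (Field r)"
  proof (rule inj_onI, rule ccontr)
    fix x y assume xy: "x \<in> Field r" "y \<in> Field r" "f x = f y" "x \<noteq> y"
    then have "x \<in> underS y \<or> y \<in> underS x"
      using TOTALS unfolding underS_def by auto
    then show False using f xy by (metis DiffD2 imageI)
  qed
  then show ?thesis using f by blast
qed

section \<open>Diagonal intersections of clubs\<close>

locale regular_uncountable =
  fixes r :: "'a rel"
  assumes card: "Card_order r" and regular: "regularCard r" and uncountable: "natLeq <o r"

sublocale regular_uncountable \<subseteq> wo_rel r
  using card by unfold_locales (simp add: card_order_on_well_order_on)

context regular_uncountable
begin

lemma infinite_Field: "infinite (Field r)"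
  using uncountable card cinfinite_mono natLeq_cinfinite ordLess_imp_ordLeq
  unfolding cinfinite_def by blast

lemma singleton_small: "|{a}| <o r"
  using finite_ordLess_infinite[OF card_of_Well_order[of "{a}"] WELL] infinite_Field
  by (simp add: Field_card_of)

lemma under_small:
  assumes "a \<in> Field r" shows "|under a| <o r"
proof -
  have "|underS a \<union> {a}| <o r"
    by (rule card_of_Un_ordLess_infinite_Field
        [OF infinite_Field card card_of_underS[OF card assms] singleton_small])
  then show ?thesis
    by (simp add: Refl_under_underS[OF REFL assms])
qed

lemma underS_trans1: "(a, b) \<in> r \<Longrightarrow> b \<in> underS c \<Longrightarrow> a \<in> underS c"
  using TRANS ANTISYM unfolding underS_def trans_def antisym_def by blast

lemma underS_trans2: "a \<in> underS b \<Longrightarrow> (b, c) \<in> r \<Longrightarrow> a \<in> underS c"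
  using TRANS ANTISYM unfolding underS_def trans_def antisym_def by blast

lemma underS_linear: "a \<in> Field r \<Longrightarrow> b \<in> Field r \<Longrightarrow> (a, b) \<in> r \<or> b \<in> underS a"
  using TOTALS REFL unfolding underS_def refl_on_def by auto

lemma small_set_bounded:
  assumes "K \<subseteq> Field r" "|K| <o r"
  shows "\<exists>b \<in> Field r. \<forall>k \<in> K. (k, b) \<in> r"
proof -
  have "\<not> cofinal K r"
    using regular assms not_ordLess_ordIso unfolding regularCard_def by blast
  then obtain b where b: "b \<in> Field r" "\<forall>k \<in> K. b \<noteq> k \<longrightarrow> (b, k) \<notin> r"
    unfolding cofinal_def by blast
  have "(k, b) \<in> r" if "k \<in> K" for k
    using underS_linear[of k b] b assms(1) that unfolding underS_def by blast
  then show ?thesis using b by blast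
qed

text \<open>
  Countable sets are bounded because the cofinality is uncountable; the least upper bound of a
  strictly increasing sequence is a limit that the sequence approaches.
\<close>

lemma increasing_sequence_sup:
  assumes inc: "\<And>n :: nat. s n \<in> underS (s (Suc n))"
  shows "\<exists>d \<in> Field r. (\<forall>n. s n \<in> underS d) \<and> (\<forall>b \<in> underS d. \<exists>n. b \<in> underS (s n))"
proof -
  have ran: "range s \<subseteq> Field r"
    using inc underS_Field by fast
  have "|range s| \<le>o natLeq"
    using card_of_image[of s UNIV] card_of_nat ordLeq_ordIso_trans by blast
  then have "|range s| <o r"
    using uncountable ordLeq_ordLess_trans by blast
  let ?U = "{b \<in> Field r. \<forall>n. (s n, b) \<in> r}"
  have U: "?U \<subseteq> Field r" "?U \<noteq> {}"
    using small_set_bounded[OF ran \<open>|range s| <o r\<close>] by auto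
  define d where "d = minim ?U"
  have d: "d \<in> ?U" unfolding d_def by (rule minim_in[OF U])
  have "s n \<in> underS d" for n
    using underS_trans2[OF inc] d by blast
  moreover have "\<exists>n. b \<in> underS (s n)" if b: "b \<in> underS d" for b
  proof (rule ccontr)
    assume "\<nexists>n. b \<in> underS (s n)"
    moreover have bF: "b \<in> Field r" using b underS_Field by fast
    ultimately have "b \<in> ?U" using underS_linear ran by blast
    then have "(d, b) \<in> r" unfolding d_def by (rule minim_least[OF U(1)])
    then show False using underS_trans1[OF _ b] underS_notIn by fast
  qed
  ultimately show ?thesis using d by blast
qed

lemma clubs_meet_common_interval:
  assumes clubs: "\<And>X. X \<in> K \<Longrightarrow> club r X" and small: "|K| <o r" and a: "a \<in> Field r"
  shows "\<exists>b \<in> Field r. \<forall>X \<in> K. \<exists>c \<in> X. a \<in> underS c \<and> (c, b) \<in> r"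
proof -
  have "\<exists>c. c \<in> X \<and> a \<in> underS c" if "X \<in> K" for X
    using clubs[OF that] a unfolding club_def cofinal_def underS_def by blast
  then obtain f where f: "\<And>X. X \<in> K \<Longrightarrow> f X \<in> X \<and> a \<in> underS (f X)" by metis
  have "f ` K \<subseteq> Field r" using f clubs unfolding club_def by blast
  moreover have "|f ` K| <o r"
    using small card_of_image ordLeq_ordLess_trans by blast
  ultimately obtain b where "b \<in> Field r" "\<forall>k \<in> f ` K. (k, b) \<in> r"
    using small_set_bounded by blast
  then show ?thesis using f by blast
qed

lemma closed_mem:
  assumes "club r C" "d \<in> Field r" "underS d \<noteq> {}"
    and "\<And>b. b \<in> underS d \<Longrightarrow> \<exists>c \<in> C. c \<in> underS d \<and> b \<in> underS c"
  shows "d \<in> C"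
proof -
  have "\<forall>b \<in> underS d. \<exists>c \<in> C \<inter> underS d. b \<noteq> c \<and> (b, c) \<in> r"
    using assms(4) unfolding underS_def by blast
  then show ?thesis
    using assms(1-3) unfolding club_def closed_in_card_def by blast
qed

text \<open>
  Closedness holds because those points of the set that lie above \<open>e\<close> belong to \<open>F e\<close>, so a limit
  \<open>d > e\<close> of points of the set is a limit of points of \<open>F e\<close>. For
  unboundedness, climb from \<open>a\<close> in \<open>\<omega>\<close> steps: the step from \<open>x\<close> goes so far that \<open>D\<close> and all \<open>F e\<close>
  with \<open>e \<le> x\<close>, fewer than \<open>r\<close> clubs, have a point in between. Every \<open>e\<close> below the supremum is
  passed at some stage, from which on \<open>F e\<close> is met at every step; so the supremum is a limit of
  points of \<open>F e\<close>, and likewise of \<open>D\<close>.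
\<close>

lemma club_Int_diagonal:
  assumes D: "club r D" and F: "\<And>e. e \<in> Field r \<Longrightarrow> club r (F e)"
  shows "club r (D \<inter> {x \<in> Field r. \<forall>e \<in> underS x. x \<in> F e})" (is "club r ?E")
  unfolding club_def
proof (intro conjI)
  show "?E \<subseteq> Field r" by blast
next
  show "closed_in_card r ?E"
    unfolding closed_in_card_def
  proof (intro ballI impI, elim conjE)
    fix d assume d: "d \<in> Field r" and ne: "underS d \<noteq> {}"
      and ub: "\<forall>b \<in> underS d. \<exists>c \<in> ?E \<inter> underS d. b \<noteq> c \<and> (b, c) \<in> r"
    have lim: "\<exists>c \<in> ?E. c \<in> underS d \<and> b \<in> underS c" if "b \<in> underS d" for b
      using ub that unfolding underS_def by blast
    have "d \<in> D" using closed_mem[OF D d ne] lim by blast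
    moreover have "d \<in> F e" if e: "e \<in> underS d" for e
    proof (rule closed_mem[OF F d ne])
      show eF: "e \<in> Field r" using e underS_Field by fast
      fix b assume b: "b \<in> underS d"
      then have bF: "b \<in> Field r" using underS_Field by fast
      obtain m where m: "m \<in> underS d" "(b, m) \<in> r" "(e, m) \<in> r"
        using underS_linear[OF bF eF] underS_linear[OF eF bF] b e REFL bF eF
        unfolding refl_on_def underS_def by blast
      obtain c where c: "c \<in> ?E" "c \<in> underS d" "m \<in> underS c"
        using lim[OF m(1)] by blast
      have "e \<in> underS c" "b \<in> underS c"
        using underS_trans1 m c(3) by blast+
      then show "\<exists>c \<in> F e. c \<in> underS d \<and> b \<in> underS c"
        using c by blast
    qed
    ultimately show "d \<in> ?E" using d by blast
  qed
next
  show "cofinal ?E r"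
    unfolding cofinal_def
  proof
    fix a assume a: "a \<in> Field r"
    define meets where "meets = (\<lambda>x y X. \<exists>c \<in> X. x \<in> underS c \<and> (c, y) \<in> r)"
    have step: "\<exists>y \<in> Field r. meets x y D \<and> (\<forall>e \<in> under x. meets x y (F e))"
      if x: "x \<in> Field r" for x
    proof -
      let ?K = "{D} \<union> F ` under x"
      have "|F ` under x| <o r"
        using under_small[OF x] card_of_image ordLeq_ordLess_trans by blast
      then have "|?K| <o r"
        by (rule card_of_Un_ordLess_infinite_Field[OF infinite_Field card singleton_small])
      moreover have "club r X" if "X \<in> ?K" for X
        using that D F under_Field[of r x] by blast
      ultimately obtain b where "b \<in> Field r" "\<And>X. X \<in> ?K \<Longrightarrow> meets x b X"
        using clubs_meet_common_interval[OF _ _ x, of ?K] unfolding meets_def by metis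
      then show ?thesis by (intro bexI[of _ b]) simp_all
    qed
    have "\<exists>s. \<forall>n :: nat. (s n \<in> Field r \<and> (n = 0 \<longrightarrow> s n = a)) \<and>
      meets (s n) (s (Suc n)) D \<and> (\<forall>e \<in> under (s n). meets (s n) (s (Suc n)) (F e))"
    proof (rule dependent_nat_choice)
      show "\<exists>x. x \<in> Field r \<and> ((0 :: nat) = 0 \<longrightarrow> x = a)" using a by simp
    next
      fix x and n :: nat
      assume "x \<in> Field r \<and> (n = 0 \<longrightarrow> x = a)"
      then show "\<exists>y. (y \<in> Field r \<and> (Suc n = 0 \<longrightarrow> y = a)) \<and>
        meets x y D \<and> (\<forall>e \<in> under x. meets x y (F e))"
        using step[of x] by auto
    qed
    then obtain s where s0: "\<And>n :: nat. s n \<in> Field r \<and> (n = 0 \<longrightarrow> s n = a)"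
      and s: "\<And>n. meets (s n) (s (Suc n)) D \<and> (\<forall>e \<in> under (s n). meets (s n) (s (Suc n)) (F e))"
      by blast
    have "s n \<in> underS (s (Suc n))" for n
      using s[of n] underS_trans2 unfolding meets_def by blast
    note inc = this
    have mono: "(s i, s j) \<in> r" if "i \<le> j" for i j
      using that
    proof (induction j rule: dec_induct)
      case base
      show ?case using s0 REFL unfolding refl_on_def by blast
    next
      case (step n)
      then show ?case using inc[of n] TRANS unfolding underS_def trans_def by blast
    qed
    obtain d where d: "d \<in> Field r" "\<And>n. s n \<in> underS d"
      and dsup: "\<And>b. b \<in> underS d \<Longrightarrow> \<exists>n. b \<in> underS (s n)"
      using increasing_sequence_sup[of s, OF inc] by blast
    have ne: "underS d \<noteq> {}" using d(2) by blast
    have limit: "d \<in> X"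
      if X: "club r X" and k: "\<And>n. k \<le> n \<Longrightarrow> meets (s n) (s (Suc n)) X" for X and k :: nat
    proof (rule closed_mem[OF X d(1) ne])
      fix b assume "b \<in> underS d"
      then obtain n where n: "b \<in> underS (s n)" using dsup by blast
      \<comment> \<open>Stage \<open>n\<close> is past \<open>b\<close>, and from stage \<open>k\<close> on every step meets \<open>X\<close>.\<close>
      have "b \<in> underS (s (max n k))" using underS_trans2[OF n mono] by simp
      moreover obtain c where "c \<in> X" "s (max n k) \<in> underS c" "(c, s (Suc (max n k))) \<in> r"
        using k[of "max n k"] unfolding meets_def by auto
      ultimately show "\<exists>c \<in> X. c \<in> underS d \<and> b \<in> underS c"
        using underS_trans1[OF _ d(2)] underS_trans2 unfolding underS_def by blast
    qed
    have "d \<in> D" using limit[OF D] s by blast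
    moreover have "d \<in> F e" if e: "e \<in> underS d" for e
    proof -
      obtain k where k: "e \<in> underS (s k)" using dsup[OF e] by blast
      have "e \<in> under (s n)" if "k \<le> n" for n
        using underS_trans2[OF k mono[OF that]] unfolding underS_def under_def by blast
      then have "meets (s n) (s (Suc n)) (F e)" if "k \<le> n" for n
        using s that by blast
      moreover have "e \<in> Field r" using e underS_Field by fast
      ultimately show ?thesis using limit[OF F] by blast
    qed
    ultimately have "d \<in> ?E" using d(1) by blast
    then show "\<exists>b \<in> ?E. a \<noteq> b \<and> (a, b) \<in> r"
      using d(2)[of 0] s0[of 0] unfolding underS_def by blast
  qed
qed

end

section \<open>Galvin's property\<close>

lemma card_of_Pow_mono:
  assumes "|A| \<le>o |B|" shows "|Pow A| \<le>o |Pow B|"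
proof -
  obtain f where f: "inj_on f A" "f ` A \<subseteq> B"
    using assms unfolding card_of_ordLeq[symmetric] by blast
  have "inj_on (image f) (Pow A)" "image f ` Pow A \<subseteq> Pow B"
    using f inj_on_image_Pow[OF f(1)] by auto
  then show ?thesis unfolding card_of_ordLeq[symmetric] by blast
qed

lemma card_of_Pow_cexp: "Card_order \<theta> \<Longrightarrow> ctwo ^c \<theta> =o |Pow (Field \<theta>)|"
  unfolding ctwo_def cexp_def Field_card_of by (rule ordIso_symmetric[OF card_of_Pow_Func])

text \<open>
  If \<open>2\<^sup>X\<close> already equals \<open>2\<^sup>r\<close>, then by monotonicity so does \<open>2\<^sup>\<theta>\<close> for every \<open>\<theta>\<close> between \<open>|X|\<close> and
  \<open>r\<close>, and the powers are constant from \<open>|X|\<close> on.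
\<close>

lemma Pow_small_subset_smaller:
  fixes r :: "'a rel" and X :: "'a set"
  assumes r: "Card_order r" and nc: "\<not> powers_eventually_constant r" and X: "|X| <o r"
  shows "|Pow X| <o |Pow (Field r)|"
proof (rule ccontr)
  assume "\<not> ?thesis"
  then have ge: "|Pow (Field r)| \<le>o |Pow X|"
    by (simp add: not_ordLess_iff_ordLeq card_of_Well_order)
  have same: "ctwo ^c \<theta> =o |Pow X|"
    if \<theta>: "Card_order \<theta>" "|X| \<le>o \<theta>" "\<theta> <o r" for \<theta> :: "'a rel"
  proof -
    have "|X| \<le>o |Field \<theta>|"
      using \<theta> card_of_Field_ordIso ordIso_symmetric ordLeq_ordIso_trans by blast
    then have "|Pow X| \<le>o |Pow (Field \<theta>)|"
      by (rule card_of_Pow_mono)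
    moreover have "|Field \<theta>| \<le>o |Field r|"
      using \<theta>(3) ordLess_imp_ordLeq card_of_mono2 by blast
    then have "|Pow (Field \<theta>)| \<le>o |Pow X|"
      using card_of_Pow_mono ge ordLeq_transitive by blast
    ultimately have "|Pow (Field \<theta>)| =o |Pow X|"
      by (simp add: ordIso_iff_ordLeq)
    then show ?thesis
      using card_of_Pow_cexp[OF \<theta>(1)] ordIso_transitive by blast
  qed
  have "ctwo ^c \<theta> =o ctwo ^c \<theta>'"
    if "Card_order \<theta> \<and> |X| \<le>o \<theta> \<and> \<theta> <o r \<and> Card_order \<theta>' \<and> |X| \<le>o \<theta>' \<and> \<theta>' <o r"
    for \<theta> \<theta>' :: "'a rel"
    using that same ordIso_symmetric ordIso_transitive by blast
  then have "powers_eventually_constant r"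
    unfolding powers_eventually_constant_def using X card_of_Card_order by blast
  then show False using nc by blast
qed

text \<open>
  The Galvin argument. Agreement is required on \<open>under i\<close>, which includes \<open>i\<close> itself, because the
  diagonal intersection decides membership of \<open>x\<close> in \<open>D (f e)\<close> only for \<open>e\<close> strictly below \<open>x\<close>, which
  leaves \<open>e = x\<close> to the traces.
\<close>

lemma (in regular_uncountable) galvin_property_Pow:
  assumes small: "\<And>i. i \<in> Field r \<Longrightarrow> |Pow (under i)| <o |Pow (Field r)|"
  shows "galvin_property r (club_filter r) |Pow (Field r)|"
  unfolding galvin_property_def Field_card_of
proof (intro allI impI)
  fix C :: "'a set \<Rightarrow> 'a set"
  assume mem: "\<forall>\<alpha> \<in> Pow (Field r). C \<alpha> \<in> club_filter r"
  have C: "C \<alpha> \<subseteq> Field r \<and> (\<exists>D. club r D \<and> D \<subseteq> C \<alpha>)" if "\<alpha> \<in> Pow (Field r)" for \<alpha>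
    using bspec[OF mem that] by (simp add: club_filter_def)
  define D where "D = (\<lambda>\<alpha>. SOME D. club r D \<and> D \<subseteq> C \<alpha>)"
  have D: "club r (D \<alpha>) \<and> D \<alpha> \<subseteq> C \<alpha>" if "\<alpha> \<in> Pow (Field r)" for \<alpha>
    unfolding D_def by (rule someI_ex) (use C[OF that] in simp)
  have "|(\<lambda>\<alpha>. D \<alpha> \<inter> under i) ` Pow (Field r)| <o |Pow (Field r)|" if "i \<in> Field r" for i
  proof -
    have "|(\<lambda>\<alpha>. D \<alpha> \<inter> under i) ` Pow (Field r)| \<le>o |Pow (under i)|"
      by (rule card_of_mono1) blast
    then show ?thesis using small[OF that] ordLeq_ordLess_trans by blast
  qed
  then obtain X where X: "X \<in> Pow (Field r)"
    and large: "\<And>i. i \<in> Field r \<Longrightarrow>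
      |Field r| \<le>o |{Y \<in> Pow (Field r). D Y \<inter> under i = D X \<inter> under i}|"
    using colourings_common_large_class[OF infinite_Field, of "\<lambda>i \<alpha>. D \<alpha> \<inter> under i"] by blast
  have "r \<le>o |{Y \<in> Pow (Field r). D Y \<inter> under i = D X \<inter> under i}|" if "i \<in> Field r" for i
    using large[OF that] card_of_Field_ordIso[OF card] ordIso_symmetric ordIso_ordLeq_trans
    by blast
  then obtain f where inj: "inj_on f (Field r)"
    and f: "\<And>i. i \<in> Field r \<Longrightarrow> f i \<in> Pow (Field r) \<and> D (f i) \<inter> under i = D X \<inter> under i"
    using injective_choice_from_large_sets[OF card,
      of "\<lambda>i. {Y \<in> Pow (Field r). D Y \<inter> under i = D X \<inter> under i}"] by blast
  let ?I = "f ` Field r" and ?E = "D X \<inter> {x \<in> Field r. \<forall>e \<in> underS x. x \<in> D (f e)}"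
  have "club r ?E"
    using club_Int_diagonal[of "D X" "\<lambda>e. D (f e)"] D X f by blast
  moreover have "?E \<subseteq> (\<Inter>\<alpha>\<in>?I. C \<alpha>)"
  proof
    fix x assume x: "x \<in> ?E"
    have "x \<in> D (f e)" if e: "e \<in> Field r" for e
    proof (cases "e \<in> underS x")
      case True
      then show ?thesis using x by blast
    next
      case False
      then have "x \<in> under e" using underS_linear[of x e] x e unfolding under_def by blast
      then show ?thesis using f[OF e] x by blast
    qed
    then show "x \<in> (\<Inter>\<alpha>\<in>?I. C \<alpha>)" using D f by blast
  qed
  moreover have "(\<Inter>\<alpha>\<in>?I. C \<alpha>) \<subseteq> Field r"
  proof -
    obtain e where e: "e \<in> Field r" using infinite_Field by fastforce
    then have "(\<Inter>\<alpha>\<in>?I. C \<alpha>) \<subseteq> C (f e)" by (intro INF_lower imageI)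
    moreover have "C (f e) \<subseteq> Field r" using C[of "f e"] f[OF e] by simp
    ultimately show ?thesis by (rule subset_trans)
  qed
  ultimately have "(\<Inter>\<alpha>\<in>?I. C \<alpha>) \<in> club_filter r"
    unfolding club_filter_def by blast
  moreover have "|?I| =o r"
    using card_of_ordIsoI[OF inj_on_imp_bij_betw[OF inj]] card_of_Field_ordIso[OF card]
      ordIso_symmetric ordIso_transitive by blast
  moreover have "?I \<subseteq> Pow (Field r)" using f by blast
  ultimately show "\<exists>I \<subseteq> Pow (Field r). |I| =o r \<and> (\<Inter>\<alpha>\<in>I. C \<alpha>) \<in> club_filter r"
    by blast
qed

theorem corollary2p10:
  fixes r :: "'a rel"
  assumes "weakly_inaccessible r"
    and "\<not> powers_eventually_constant r"
  shows "\<exists>m :: 'a set rel. Card_order m \<and> m \<le>o ctwo ^c r \<and>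
           galvin_property r (club_filter r) m"
proof (intro exI conjI)
  interpret regular_uncountable r
    using assms(1) unfolding weakly_inaccessible_def uncountable_card_def
    by unfold_locales blast+
  show "Card_order |Pow (Field r)|" by (rule card_of_Card_order)
  show "|Pow (Field r)| \<le>o ctwo ^c r"
    using card_of_Pow_cexp[OF card] ordIso_symmetric ordIso_imp_ordLeq by blast
  show "galvin_property r (club_filter r) |Pow (Field r)|"
    by (rule galvin_property_Pow[OF Pow_small_subset_smaller[OF card assms(2) under_small]])
qed

end
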